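(* For each $\epsilon>0$ there exists no online ABC rule that satisfies $(1-\epsilon)\mathrm{H}(k)$-EJR, where $\mathrm{H}(k)=\sum_{j=1}^k 1/j$. That is, for every $\epsilon>0$ and every online ABC rule there exist an approval-based election, with some committee size $k$, and an arrival order of its candidates for which the committee selected by the rule does not satisfy $(1-\epsilon)\mathrm{H}(k)$-EJR.
   Context: An approval-based election consists of a finite set $C$ of $m$ candidates, a set $N=\{1,\dots,n\}$ of voters, a committee size $k$ with $1\le k\le m$, and for each voter $i\in N$ a set $A(i)\subseteq C$ of approved candidates. $N(c)=\{i\in N: c\in A(i)\}$. An online ABC rule is a (deterministic) algorithm that processes the candidates in their arrival order $c_1,\dots,c_m$. When $c_t$ arrives, $N(c_t)$ is revealed and the algorithm decides irrevocably whether $c_t$ is included in the committee; the decision may depend on $n,m,k$ and on $N(c_1),\dots,N(c_t)$, but not on the approvals of later candidates. At the end it must have selected a committee of exactly $k$ candidates. For a real number $\alpha$ and $\ell\in\{1,\dots,k\}$, a group $S\subseteq N$ is $\alpha$-$\ell$-cohesive if $|S|\ge \alpha\cdot\ell\cdot n/k$ and $\left|\bigcap_{i\in S}A(i)\right|\ge \ell$. A committee $W\subseteq C$ satisfies $\alpha$-EJR if for each $\ell\in\{1,\dots,k\}$ and each $\alpha$-$\ell$-cohesive group $S$ there is a voter $i\in S$ with $|A(i)\cap W|\ge \ell$. An online ABC rule satisfies $\alpha$-EJR (where $\alpha$ may depend on $k$) if for every election and every arrival order the committee it selects satisfies $\alpha$-EJR. *)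

theory Defs
  imports "HOL-Analysis.Harmonic_Numbers"
begin

text \<open>
  An election is given by a candidate set \<open>C\<close>, a number \<open>n\<close> of voters, a committee size \<open>k\<close> and
  approval sets \<open>A i\<close>; the voters are \<open>1, \<dots>, n\<close>, and there is at least one of them. The values of
  \<open>A\<close> outside \<open>{1..n}\<close> are never used.
\<close>

definition is_election :: "'c set \<Rightarrow> nat \<Rightarrow> nat \<Rightarrow> (nat \<Rightarrow> 'c set) \<Rightarrow> bool" where
  "is_election C n k A \<longleftrightarrow>
     finite C \<and> 1 \<le> n \<and> 1 \<le> k \<and> k \<le> card C \<and> (\<forall>i\<in>{1..n}. A i \<subseteq> C)"

definition supporters :: "nat \<Rightarrow> (nat \<Rightarrow> 'c set) \<Rightarrow> 'c \<Rightarrow> nat set" where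
  "supporters n A c = {i \<in> {1..n}. c \<in> A i}"

definition arrival_order :: "'c set \<Rightarrow> 'c list \<Rightarrow> bool" where
  "arrival_order C cs \<longleftrightarrow> distinct cs \<and> set cs = C"

text \<open>
  The condition \<open>S \<noteq> {}\<close> only matters for \<open>\<alpha> \<le> 0\<close>: for \<open>\<alpha> > 0\<close> the size bound implies it. It keeps
  the empty group, whose intersection of approval sets is meaningless, from violating EJR.
\<close>

definition cohesive :: "nat \<Rightarrow> nat \<Rightarrow> (nat \<Rightarrow> 'c set) \<Rightarrow> real \<Rightarrow> nat \<Rightarrow> nat set \<Rightarrow> bool" where
  "cohesive n k A \<alpha> l S \<longleftrightarrow>
     S \<subseteq> {1..n} \<and> S \<noteq> {} \<and>
     real (card S) \<ge> \<alpha> * real l * real n / real k \<and>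
     card (\<Inter>i\<in>S. A i) \<ge> l"

definition EJR :: "nat \<Rightarrow> nat \<Rightarrow> (nat \<Rightarrow> 'c set) \<Rightarrow> real \<Rightarrow> 'c set \<Rightarrow> bool" where
  "EJR n k A \<alpha> W \<longleftrightarrow>
     (\<forall>l\<in>{1..k}. \<forall>S. cohesive n k A \<alpha> l S \<longrightarrow> (\<exists>i\<in>S. card (A i \<inter> W) \<ge> l))"

text \<open>
  A decision function receives \<open>n\<close>, \<open>m\<close>, \<open>k\<close> and the list \<open>[N(c\<^sub>1), \<dots>, N(c\<^sub>t)]\<close> of supporter sets
  revealed so far, and returns whether \<open>c\<^sub>t\<close> is included. Its own earlier decisions need not be an
  argument, since they are determined by prefixes of this list.
\<close>

type_synonym decision = "nat \<Rightarrow> nat \<Rightarrow> nat \<Rightarrow> nat set list \<Rightarrow> bool"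

definition committee :: "decision \<Rightarrow> nat \<Rightarrow> nat \<Rightarrow> (nat \<Rightarrow> 'c set) \<Rightarrow> 'c list \<Rightarrow> 'c set" where
  "committee d n k A cs =
     {cs ! t | t. t < length cs \<and>
        d n (length cs) k (map (supporters n A) (take (Suc t) cs))}"

text \<open>
  Decisions do not see the names of candidates, so taking candidates to be natural numbers
  covers all elections.
\<close>

definition online_ABC_rule :: "decision \<Rightarrow> bool" where
  "online_ABC_rule d \<longleftrightarrow>
     (\<forall>(C :: nat set) n k A cs. is_election C n k A \<and> arrival_order C cs \<longrightarrow>
        card (committee d n k A cs) = k)"

definition satisfies_EJR :: "decision \<Rightarrow> (nat \<Rightarrow> real) \<Rightarrow> bool" where
  "satisfies_EJR d \<alpha> \<longleftrightarrow>
     (\<forall>(C :: nat set) n k A cs. is_election C n k A \<and> arrival_order C cs \<longrightarrow>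
        EJR n k A (\<alpha> k) (committee d n k A cs))"

end

theory Submission
  imports Defs
begin

text \<open>
  Fix an integer \<open>q \<ge> \<alpha> n / k\<close>. In phase \<open>l = 1, 2, \<dots>, L\<close> the adversary splits the voters into
  \<open>\<lfloor>n / (q l)\<rfloor>\<close> disjoint groups of size \<open>q l\<close> (ignoring leftovers) and, for each group in turn, presents
  candidates approved by exactly that group until one of them is selected. Before its turn in phase
  \<open>l\<close> a group contains only voters with at most \<open>l - 1\<close> selected approved candidates; so if \<open>l\<close>
  candidates in a row were rejected, presenting only unapproved candidates from then on would
  violate EJR. Hence every group costs one seat, and the rule has to fill
  \<open>\<Sum>l=1..L. \<lfloor>n / (q l)\<rfloor>\<close> seats, about \<open>k H(L) / \<alpha> - L\<close>. For \<open>k = L D\<close> with \<open>D\<close> a large constant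
  and \<open>L \<rightarrow> \<infinity>\<close>, this exceeds \<open>k\<close> because \<open>H(L D) \<le> H(L) + D\<close>.
\<close>

section \<open>Selected supporter sets along a sequence of arrivals\<close>

text \<open>The supporter sets of the selected candidates, listed in arrival order.\<close>

definition chosen :: "('s list \<Rightarrow> bool) \<Rightarrow> 's list \<Rightarrow> 's list" where
  "chosen f xs = map ((!) xs) (filter (\<lambda>t. f (take (Suc t) xs)) [0..<length xs])"

lemma chosen_Nil [simp]: "chosen f [] = []"
  by (simp add: chosen_def)

text \<open>The decision on an entry reads only the prefix ending there, so a later arrival leaves
  earlier decisions intact.\<close>

lemma chosen_snoc: "chosen f (xs @ [x]) = chosen f xs @ (if f (xs @ [x]) then [x] else [])"
proof -
  have "filter (\<lambda>t. f (take (Suc t) (xs @ [x]))) [0..<length xs]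
      = filter (\<lambda>t. f (take (Suc t) xs)) [0..<length xs]"
    by (rule filter_cong) auto
  then show ?thesis
    by (auto simp: chosen_def nth_append)
qed

text \<open>Positions are counted rather than values, since distinct candidates may share a
  supporter set. This links the lists to cardinalities of committees.\<close>

lemma length_filter_chosen:
  "length (filter P (chosen f xs)) = card {t. t < length xs \<and> f (take (Suc t) xs) \<and> P (xs ! t)}"
proof -
  have "length (filter P (chosen f xs))
      = length (filter (\<lambda>t. f (take (Suc t) xs) \<and> P (xs ! t)) [0..<length xs])"
    by (simp add: chosen_def filter_map o_def conj_commute)
  also have "\<dots> = card {t. t < length xs \<and> f (take (Suc t) xs) \<and> P (xs ! t)}"
    by (subst length_filter_conv_card) (auto intro!: arg_cong[where f = card])
  finally show ?thesis .
qed

lemma length_chosen: "length (chosen f xs) = card {t. t < length xs \<and> f (take (Suc t) xs)}"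
  using length_filter_chosen[of "\<lambda>_. True" f xs] by simp

lemma length_chosen_append: "length (chosen f xs) \<le> length (chosen f (xs @ ys))"
proof (induction ys rule: rev_induct)
  case (snoc y ys)
  then show ?case
    using chosen_snoc[of f "xs @ ys" y] by simp
qed simp

lemma chosen_append_replicate_Suc:
  "chosen f (xs @ replicate (Suc r) x)
    = chosen f (xs @ replicate r x) @ (if f (xs @ replicate (Suc r) x) then [x] else [])"
  using chosen_snoc[of f "xs @ replicate r x" x] by (simp add: replicate_append_same)

text \<open>Meant for \<open>x = {}\<close> and \<open>P\<close> testing membership of a voter: the
  rule may fill seats with unapproved padding, but no voter's count grows.\<close>

lemma filter_chosen_append_replicate:
  "\<not> P x \<Longrightarrow> filter P (chosen f (xs @ replicate r x)) = filter P (chosen f xs)"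
proof (induction r)
  case (Suc r)
  then show ?case
    by (cases "f (xs @ replicate (Suc r) x)") (simp_all add: chosen_append_replicate_Suc del: replicate_Suc)
qed simp

lemma chosen_append_replicate:
  assumes "\<And>s. s < r \<Longrightarrow> \<not> f (xs @ replicate (Suc s) x)"
  shows "chosen f (xs @ replicate r x) = chosen f xs"
  using assms
proof (induction r)
  case (Suc r)
  then show ?case
    by (simp add: chosen_append_replicate_Suc del: replicate_Suc)
qed simp

section \<open>The adversary against a fixed rule\<close>

text \<open>\<open>f\<close> is a rule with the numbers of voters, candidates and seats held fixed.
  The length \<open>k * Suc k\<close> leaves room for \<open>k\<close> seats at up to
  \<open>k\<close> candidates each and one further run of up to \<open>k\<close> candidates.\<close>

locale EJR_play =
  fixes f :: "nat set list \<Rightarrow> bool" and n k q :: nat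
  assumes seats: "\<And>ys. length ys = k * Suc k \<Longrightarrow> set ys \<subseteq> Pow {1..n} \<Longrightarrow> length (chosen f ys) = k"
    and represented: "\<And>ys S l. length ys = k * Suc k \<Longrightarrow> set ys \<subseteq> Pow {1..n} \<Longrightarrow> S \<subseteq> {1..n} \<Longrightarrow>
      card S = q * l \<Longrightarrow> 1 \<le> l \<Longrightarrow> l \<le> k \<Longrightarrow> l \<le> length (filter ((\<subseteq>) S) ys) \<Longrightarrow>
      \<exists>i\<in>S. l \<le> length (filter ((\<in>) i) (chosen f ys))"
begin

text \<open>\<open>v\<close> only bounds the voters' counts from above, so it may be weakened
  freely. The length bound charges at most \<open>k\<close> candidates to each filled seat.\<close>

definition reachable :: "nat \<Rightarrow> (nat \<Rightarrow> nat) \<Rightarrow> bool" where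
  "reachable c v \<longleftrightarrow> c \<le> k \<and> (\<exists>xs. set xs \<subseteq> Pow {1..n} \<and> length xs \<le> k * c \<and>
     length (chosen f xs) = c \<and> (\<forall>i. length (filter ((\<in>) i) (chosen f xs)) \<le> v i))"

lemma reachable_0: "reachable 0 (\<lambda>_. 0)"
  unfolding reachable_def by (auto intro: exI[of _ "[]"])

lemma reachable_mono: "reachable c v \<Longrightarrow> (\<And>i. v i \<le> w i) \<Longrightarrow> reachable c w"
  unfolding reachable_def by (blast intro: order_trans)

lemma reachable_step:
  assumes R: "reachable c v" and S: "S \<subseteq> {1..n}" "card S = q * l" and l: "1 \<le> l" "l \<le> k"
    and v: "\<And>i. i \<in> S \<Longrightarrow> v i < l"
  shows "reachable (Suc c) (\<lambda>i. v i + (if i \<in> S then 1 else 0))"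
proof -
  obtain xs where xs: "set xs \<subseteq> Pow {1..n}" "length xs \<le> k * c" "length (chosen f xs) = c"
      "\<And>i. length (filter ((\<in>) i) (chosen f xs)) \<le> v i" and c: "c \<le> k"
    using R unfolding reachable_def by blast
  have "length xs \<le> k * k"
    using xs(2) c by (meson le_trans mult_le_mono2)
  have "\<exists>s<l. f (xs @ replicate (Suc s) S)"
  proof (rule ccontr)
    assume "\<not> ?thesis"
    then have same: "chosen f (xs @ replicate l S) = chosen f xs"
      by (intro chosen_append_replicate) blast
    have len: "length (xs @ replicate l S) \<le> k * Suc k"
      using \<open>length xs \<le> k * k\<close> l by simp
    \<comment> \<open>Padding completes the election without helping any voter, while the
      \<open>l\<close> rejected copies of \<open>S\<close> demand a member with \<open>l\<close>
      selected candidates, against \<open>v i < l\<close>.\<close>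
    define ys where "ys = (xs @ replicate l S) @ replicate (k * Suc k - length (xs @ replicate l S)) {}"
    have ys: "length ys = k * Suc k" "set ys \<subseteq> Pow {1..n}"
      using len xs(1) S(1) by (auto simp: ys_def)
    have "l \<le> length (filter ((\<subseteq>) S) ys)"
      by (simp add: ys_def)
    from represented[OF ys S l this]
    obtain i where "i \<in> S" "l \<le> length (filter ((\<in>) i) (chosen f ys))"
      by blast
    moreover have "filter ((\<in>) i) (chosen f ys) = filter ((\<in>) i) (chosen f xs)"
      unfolding ys_def by (subst filter_chosen_append_replicate) (simp_all add: same)
    ultimately show False
      using v[of i] xs(4)[of i] by simp
  qed
  then obtain s where s: "s < l" "f (xs @ replicate (Suc s) S)"
      and min: "\<And>s'. s' < s \<Longrightarrow> \<not> (s' < l \<and> f (xs @ replicate (Suc s') S))"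
    using exists_least_iff[of "\<lambda>s. s < l \<and> f (xs @ replicate (Suc s) S)"] by blast
  \<comment> \<open>Stopping at the first accepted copy fills exactly one more seat, at a cost of
    \<open>Suc s \<le> l \<le> k\<close> candidates.\<close>
  define zs where "zs = xs @ replicate (Suc s) S"
  have "chosen f (xs @ replicate s S) = chosen f xs"
    using min s(1) by (intro chosen_append_replicate) (metis less_trans)
  then have ch: "chosen f zs = chosen f xs @ [S]"
    using s(2) by (simp add: zs_def chosen_append_replicate_Suc del: replicate_Suc)
  have len: "length zs \<le> k * Suc c"
    using xs(2) s(1) l by (simp add: zs_def)
  have sub: "set zs \<subseteq> Pow {1..n}"
    using xs(1) S(1) by (auto simp: zs_def)
  \<comment> \<open>Once padded to full length the sequence fills exactly \<open>k\<close> seats,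
    and the \<open>Suc c\<close> seats filled so far are among them.\<close>
  have "Suc c \<le> k"
  proof -
    have "length zs \<le> k * Suc k"
      using len c by (meson Suc_le_mono le_trans mult_le_mono2)
    then have "length (chosen f (zs @ replicate (k * Suc k - length zs) {})) = k"
      using sub by (intro seats) auto
    then show ?thesis
      using length_chosen_append[of f zs "replicate (k * Suc k - length zs) {}"] ch xs(3) by simp
  qed
  then show ?thesis
    unfolding reachable_def using len sub ch xs(3,4) by (auto intro!: exI[of _ zs])
qed

text \<open>The groups are consecutive intervals of voters, so each turn raises the bound on a
  longer initial segment. Index \<open>0\<close> is no voter; counting it as raised only weakens an
  upper bound.\<close>

lemma reachable_phase:
  assumes R: "reachable c (\<lambda>_. l)" and l: "Suc l \<le> k" and b: "b * (q * Suc l) \<le> n"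
  shows "reachable (c + b) (\<lambda>i. if i \<le> b * (q * Suc l) then Suc l else l)"
  using b
proof (induction b)
  case 0
  show ?case
    using R by (auto intro: reachable_mono)
next
  case (Suc b)
  let ?g = "q * Suc l" and ?S = "{b * (q * Suc l) + 1..b * (q * Suc l) + q * Suc l}"
  have "reachable (Suc (c + b))
      (\<lambda>i. (if i \<le> b * ?g then Suc l else l) + (if i \<in> ?S then 1 else 0))"
    using Suc l by (intro reachable_step[where l = "Suc l"]) (auto simp: algebra_simps)
  then show ?case
    by (auto intro: reachable_mono)
qed

lemma reachable_phases:
  "L \<le> k \<Longrightarrow> reachable (\<Sum>l=1..L. n div (q * l)) (\<lambda>_. L)"
proof (induction L)
  case 0
  show ?case
    using reachable_0 by simp
next
  case (Suc L)
  then have "reachable ((\<Sum>l=1..L. n div (q * l)) + n div (q * Suc L))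
      (\<lambda>i. if i \<le> n div (q * Suc L) * (q * Suc L) then Suc L else L)"
    by (intro reachable_phase) auto
  \<comment> \<open>Voters left over by the division get the weaker bound too, so the next phase
    starts from a uniform one.\<close>
  then have "reachable ((\<Sum>l=1..L. n div (q * l)) + n div (q * Suc L)) (\<lambda>_. Suc L)"
    by (rule reachable_mono) simp
  then show ?case
    by simp
qed

corollary seats_bound: "L \<le> k \<Longrightarrow> (\<Sum>l=1..L. n div (q * l)) \<le> k"
  using reachable_phases unfolding reachable_def by blast

end

section \<open>From online rules to the adversary's setting\<close>

text \<open>Naming candidates by arrival position realises any list of sets of voters as the
  supporter sets of an election.\<close>

lemma committee_upt:
  fixes ys :: "nat set list"
  assumes "set ys \<subseteq> Pow {1..n}"
  defines "A \<equiv> \<lambda>i. {t. t < length ys \<and> i \<in> ys ! t}"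
  shows "committee d n k A [0..<length ys]
       = {t. t < length ys \<and> d n (length ys) k (take (Suc t) ys)}"
proof -
  have "map (supporters n A) (take (Suc t) [0..<length ys]) = take (Suc t) ys"
    if "t < length ys" for t
  proof (rule nth_equalityI)
    fix j assume "j < length (map (supporters n A) (take (Suc t) [0..<length ys]))"
    then have j: "j < Suc t" "j < length ys"
      using that by auto
    then have "ys ! j \<subseteq> {1..n}"
      using assms(1) by (meson PowD nth_mem subsetD)
    then show "map (supporters n A) (take (Suc t) [0..<length ys]) ! j = take (Suc t) ys ! j"
      using j by (auto simp: supporters_def A_def)
  qed (use that in auto)
  then have "committee d n k A [0..<length ys]
      = {[0..<length ys] ! t | t. t < length ys \<and> d n (length ys) k (take (Suc t) ys)}"
    unfolding committee_def by (metis (lifting) length_upt diff_zero)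
  also have "\<dots> = {t. t < length ys \<and> d n (length ys) k (take (Suc t) ys)}"
    by (auto intro!: exI)
  finally show ?thesis .
qed

text \<open>The size threshold for cohesive groups is linear in \<open>l\<close>, so a
  \<open>q\<close> that meets it for \<open>l = 1\<close> serves every \<open>l\<close>.\<close>

lemma EJR_play_of_rule:
  assumes rule: "online_ABC_rule d" and ejr: "satisfies_EJR d \<alpha>"
    and pos: "1 \<le> n" "1 \<le> k" "1 \<le> q" and q: "\<alpha> k * real n / real k \<le> real q"
  shows "EJR_play (d n (k * Suc k) k) n k q"
proof
  fix ys :: "nat set list"
  assume len: "length ys = k * Suc k" and sub: "set ys \<subseteq> Pow {1..n}"
  let ?m = "k * Suc k"
  define A where "A = (\<lambda>i. {t. t < length ys \<and> i \<in> ys ! t})"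
  let ?W = "committee d n k A [0..<length ys]"
  have W: "?W = {t. t < length ys \<and> d n ?m k (take (Suc t) ys)}"
    unfolding A_def using committee_upt[OF sub, of d k] len by simp
  have el: "is_election {..<length ys} n k A" "arrival_order {..<length ys} [0..<length ys]"
    using pos len by (auto simp: is_election_def arrival_order_def A_def)
  show "length (chosen (d n ?m k) ys) = k"
    using rule el W unfolding online_ABC_rule_def length_chosen by metis
  fix S l
  assume S: "S \<subseteq> {1..n}" "card S = q * l" and l: "1 \<le> l" "l \<le> k"
    and common: "l \<le> length (filter ((\<subseteq>) S) ys)"
  \<comment> \<open>An intersection over the empty group would be the whole type; \<open>q\<close>
    and \<open>l\<close> being positive excludes this.\<close>
  have ne: "S \<noteq> {}"
    using S(2) l pos by auto
  have "(\<Inter>i\<in>S. A i) = {t. t < length ys \<and> S \<subseteq> ys ! t}"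
    using ne by (auto simp: A_def)
  then have "l \<le> card (\<Inter>i\<in>S. A i)"
    using common by (simp add: length_filter_conv_card)
  moreover have "\<alpha> k * real l * real n / real k \<le> real (card S)"
  proof -
    have "\<alpha> k * real l * real n / real k = (\<alpha> k * real n / real k) * real l"
      by simp
    also have "\<dots> \<le> real q * real l"
      using q by (intro mult_right_mono) auto
    finally show ?thesis
      using S(2) by simp
  qed
  ultimately have "cohesive n k A (\<alpha> k) l S"
    using S(1) ne by (simp add: cohesive_def)
  moreover have "EJR n k A (\<alpha> k) ?W"
    using ejr el unfolding satisfies_EJR_def by blast
  ultimately obtain i where i: "i \<in> S" "l \<le> card (A i \<inter> ?W)"
    using l unfolding EJR_def by (meson atLeastAtMost_iff)
  have "A i \<inter> ?W = {t. t < length ys \<and> d n ?m k (take (Suc t) ys) \<and> i \<in> ys ! t}"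
    unfolding W by (auto simp: A_def)
  then show "\<exists>i\<in>S. l \<le> length (filter ((\<in>) i) (chosen (d n ?m k) ys))"
    using i unfolding length_filter_chosen by auto
qed

section \<open>Harmonic number estimates\<close>

text \<open>Raising \<open>D \<ge> 1\<close> by one appends \<open>L\<close> terms, each at most
  \<open>1 / (L * D)\<close>, hence at most 1 in total.\<close>

lemma harm_mult_le:
  assumes "1 \<le> L"
  shows "(harm (L * D) :: real) \<le> harm L + real D"
proof (induction D)
  case (Suc D)
  have block: "harm (L * D + r) \<le> (harm (L * D) :: real) + real r / real (L * D)" if "1 \<le> D" for r
  proof (induction r)
    case (Suc r)
    have "inverse (real (Suc (L * D + r))) \<le> inverse (real (L * D))"
      using that assms by (intro le_imp_inverse_le) auto
    then show ?case
      using Suc by (simp add: harm_Suc field_simps add_divide_distrib)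
  qed simp
  show ?case
  proof (cases "D = 0")
    case False
    then have "real L / real (L * D) \<le> 1"
      using assms by (simp add: field_simps)
    then show ?thesis
      using block[of L] False Suc by (simp add: add.commute)
  qed simp
qed (simp add: harm_nonneg harm_expand)

text \<open>Each of the \<open>L\<close> floors loses at most 1.\<close>

lemma sum_div_ge:
  assumes "1 \<le> q"
  shows "real n * harm L / real q - real L \<le> real (\<Sum>l=1..L. n div (q * l))"
proof -
  have "real n * harm L / real q - real L = (\<Sum>l=1..L. real n / (real q * real l) - 1)"
    by (simp add: harm_def sum_subtractf sum_distrib_left sum_divide_distrib field_simps)
  also have "\<dots> \<le> (\<Sum>l=1..L. real (n div (q * l)))"
  proof (rule sum_mono)
    fix l
    have "real n / real (q * l) - 1 \<le> real (n div (q * l))"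
      using floor_divide_of_nat_eq[of n "q * l", where ?'a = real]
      by (metis diff_le_eq of_int_of_nat_eq real_of_int_floor_add_one_ge)
    then show "real n / (real q * real l) - 1 \<le> real (n div (q * l))"
      by simp
  qed
  finally show ?thesis
    by simp
qed

lemma exists_large_harm: "\<exists>L\<ge>1. (B::real) < harm L"
proof -
  have "eventually (\<lambda>L. B < (harm L :: real)) sequentially"
    using harm_at_top by (simp add: filterlim_at_top_dense)
  then have "eventually (\<lambda>L. 1 \<le> L \<and> B < (harm L :: real)) sequentially"
    using eventually_ge_at_top by (rule eventually_conj[rotated])
  then show ?thesis
    using eventually_happens by fastforce
qed

section \<open>Choice of constants and contradiction\<close>

theorem theorem5p3:
  fixes \<epsilon> :: real
  assumes "\<epsilon> > 0"
  shows "\<not> (\<exists>d. online_ABC_rule d \<and> satisfies_EJR d (\<lambda>k. (1 - \<epsilon>) * harm k))"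
proof
  assume "\<exists>d. online_ABC_rule d \<and> satisfies_EJR d (\<lambda>k. (1 - \<epsilon>) * harm k)"
  then obtain d where d: "online_ABC_rule d" "satisfies_EJR d (\<lambda>k. (1 - \<epsilon>) * harm k)"
    by blast
  \<comment> \<open>Capping \<epsilon> at 1/2 keeps \<delta> positive even when
    \<open>1 - \<epsilon>\<close> is not.\<close>
  define \<delta> where "\<delta> = 1 - min \<epsilon> (1/2)"
  have \<delta>: "0 < \<delta>" "\<delta> < 1" "1 - \<epsilon> \<le> \<delta>"
    using assms by (auto simp: \<delta>_def min_def)
  \<comment> \<open>This choice says \<open>\<delta> < D / (D + 1)\<close>, which makes \<gamma>
    positive.\<close>
  obtain D where D: "\<delta> / (1 - \<delta>) < real D"
    using reals_Archimedean2 by blast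
  define \<gamma> where "\<gamma> = real D - (real D + 1) * \<delta>"
  have \<gamma>: "0 < \<gamma>"
    using D \<delta> by (simp add: \<gamma>_def field_simps)
  have "0 < \<delta> / (1 - \<delta>)"
    using \<delta> by simp
  then have D_pos: "1 \<le> D"
    using D by (cases D) auto
  \<comment> \<open>The threshold is the one that the final bound
    \<open>\<gamma> * harm L \<le> (D + 1) * (D + 1)\<close> contradicts.\<close>
  obtain L where L: "1 \<le> L" "(real D + 1) * (real D + 1) / \<gamma> < harm L"
    using exists_large_harm by blast
  define k where "k = L * D"
  have k: "1 \<le> k" "L \<le> k"
    using L(1) D_pos by (auto simp: k_def)
  \<comment> \<open>With \<open>k * k\<close> voters the ratio of voters to seats is
    \<open>k\<close>, so \<open>q\<close> is the group size threshold for
    \<open>\<delta> * harm k\<close>, rounded up.\<close>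
  define q where "q = nat \<lceil>\<delta> * harm k * real k\<rceil>"
  have harm_k: "0 < (harm k :: real)"
    using k by (simp add: harm_pos)
  have q_pos: "1 \<le> q"
    using \<delta> harm_k k by (simp add: q_def Suc_le_eq)
  have q_ge: "\<delta> * harm k * real k \<le> real q"
    unfolding q_def by (rule real_nat_ceiling_ge)
  have q_le: "real q \<le> \<delta> * harm k * real k + 1"
  proof -
    have "0 \<le> \<delta> * harm k * real k"
      using \<delta> by (intro mult_nonneg_nonneg harm_nonneg) auto
    then show ?thesis
      unfolding q_def by linarith
  qed
  have "(1 - \<epsilon>) * harm k * real (k * k) / real k \<le> real q"
  proof -
    have "(1 - \<epsilon>) * harm k * real (k * k) / real k = (1 - \<epsilon>) * (harm k * real k)"
      using k by simp
    also have "\<dots> \<le> \<delta> * (harm k * real k)"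
      using \<delta> by (intro mult_right_mono mult_nonneg_nonneg harm_nonneg) auto
    finally show ?thesis
      using q_ge by simp
  qed
  then interpret EJR_play "d (k * k) (k * Suc k) k" "k * k" k q
    using k q_pos by (intro EJR_play_of_rule[OF d]) auto
  have "real (k * k) * harm L / real q - real L \<le> real k"
    using sum_div_ge[OF q_pos, of "k * k" L] seats_bound[OF k(2)] by linarith
  then have "real k * real k * harm L \<le> (real k + real L) * real q"
    using q_pos by (simp add: field_simps)
  also have "\<dots> \<le> (real k + real L) * (\<delta> * harm k * real k + 1)"
    using q_le by (intro mult_left_mono) auto
  \<comment> \<open>The rounding error 1 is absorbed by \<open>1 \<le> k\<close>.\<close>
  also have "\<dots> \<le> (real k + real L) * (real k * (\<delta> * harm k + 1))"
    using k by (intro mult_left_mono) (auto simp: algebra_simps)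
  \<comment> \<open>Here \<open>k + L = L * (D + 1)\<close>, so the factor \<open>k * L\<close> can
    be cancelled from both sides.\<close>
  also have "\<dots> = real k * real L * ((real D + 1) * (\<delta> * harm k + 1))"
    by (simp add: k_def algebra_simps)
  finally have "real k * real L * (real D * harm L) \<le> real k * real L * ((real D + 1) * (\<delta> * harm k + 1))"
    by (simp add: k_def algebra_simps)
  then have "real D * harm L \<le> (real D + 1) * (\<delta> * harm k + 1)"
    using k L(1) by (subst (asm) mult_le_cancel_left_pos) auto
  \<comment> \<open>Replacing \<open>harm k\<close> by \<open>harm L\<close> costs only a constant
    depending on \<open>D\<close>, so both sides become linear in \<open>harm L\<close>, with slopes
    differing by \<gamma>.\<close>
  also have "\<dots> \<le> (real D + 1) * (\<delta> * harm L + real D + 1)"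
  proof -
    have "\<delta> * harm k \<le> \<delta> * harm L + \<delta> * real D"
      using mult_left_mono[OF harm_mult_le[OF L(1), of D], of \<delta>] \<delta>
      by (simp add: k_def algebra_simps)
    moreover have "\<delta> * real D \<le> real D"
      using \<delta> by (simp add: mult_left_le_one_le)
    ultimately show ?thesis
      by (intro mult_left_mono) auto
  qed
  finally have "\<gamma> * harm L \<le> (real D + 1) * (real D + 1)"
    by (simp add: \<gamma>_def algebra_simps)
  then show False
    using L(2) \<gamma> by (simp add: field_simps)
qed

end
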